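(* Let $A$ and $X$ be linear orders. Then $AX\cong X$ if and only if $X$ is isomorphic to an order of the form $A^{\omega}(I_{[u]})$, i.e. to a replacement $A^{\omega}(I_u)$ where $(I_u)_{u\in A^\omega}$ is a family of linear orders (possibly empty) such that $I_u=I_v$ whenever $u\sim v$.
   Context: $AX$ is the lexicographic product $A\times X$. $A^\omega$ is the set of infinite sequences of elements of $A$ ordered lexicographically. Tail-equivalence: $u\sim v$ in $A^\omega$ iff there exist finite sequences $r,s$ (of any lengths) and $u'\in A^\omega$ with $u=ru'$, $v=su'$ (concatenation). Replacement: for a linear order $Y$ and orders $I_y$ ($y\in Y$, possibly empty), $Y(I_y)$ is the set $\{(y,i): y\in Y, i\in I_y\}$ ordered lexicographically (each point $y$ is replaced by a copy of $I_y$). *)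

theory Defs
  imports Main "HOL-Library.Stream"
begin

text \<open>
  A linear order is a reflexive relation \<^term>\<open>r\<close> with \<^term>\<open>Linear_order r\<close>; its underlying set
  is \<^term>\<open>Field r\<close>, so the empty order is included.
\<close>

text \<open>
  The predicate \<^const>\<open>iso\<close> is stated in the library via initial segments, but for arbitrary
  relations it says exactly that \<open>f\<close> is a bijection between the fields preserving and reflecting
  the relations (fact \<open>iso_iff2\<close>); well-foundedness plays no role.
\<close>

definition order_isomorphic :: "'a rel \<Rightarrow> 'b rel \<Rightarrow> bool"  (infix \<open>\<cong>\<^sub>o\<close> 50)
  where "r \<cong>\<^sub>o s \<longleftrightarrow> (\<exists>f. iso r s f)"

text \<open>
  The first coordinate is the dominant one. The library's \<open><*lex*>\<close> is meant for strict relations: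
  applied to a reflexive first component it would not compare second coordinates.
\<close>

definition lex_product :: "'a rel \<Rightarrow> 'b rel \<Rightarrow> ('a \<times> 'b) rel"
  where "lex_product A X =
    {((a, x), (b, y)). a \<in> Field A \<and> b \<in> Field A \<and> x \<in> Field X \<and> y \<in> Field X \<and>
       (a \<noteq> b \<and> (a, b) \<in> A \<or> a = b \<and> (x, y) \<in> X)}"

definition omega_power :: "'a rel \<Rightarrow> 'a stream rel"
  where "omega_power A =
    {(u, v). u \<in> streams (Field A) \<and> v \<in> streams (Field A) \<and>
       (u = v \<or> (\<exists>n. (\<forall>k<n. u !! k = v !! k) \<and> u !! n \<noteq> v !! n \<and> (u !! n, v !! n) \<in> A))}"

definition tail_equiv :: "'a set \<Rightarrow> 'a stream \<Rightarrow> 'a stream \<Rightarrow> bool"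
  where "tail_equiv C u v \<longleftrightarrow>
    (\<exists>r \<in> lists C. \<exists>s \<in> lists C. \<exists>u' \<in> streams C. u = r @- u' \<and> v = s @- u')"

definition replacement :: "'y rel \<Rightarrow> ('y \<Rightarrow> 'i rel) \<Rightarrow> ('y \<times> 'i) rel"
  where "replacement Y I =
    {((y, i), (z, j)). y \<in> Field Y \<and> z \<in> Field Y \<and> i \<in> Field (I y) \<and> j \<in> Field (I z) \<and>
       (y \<noteq> z \<and> (y, z) \<in> Y \<or> y = z \<and> (i, j) \<in> I y)}"

text \<open>
  The type \<open>'i\<close> cannot be quantified existentially. If an order \<open>X\<close> on \<open>'x\<close> is isomorphic to
  \<open>A\<^sup>\<omega>(I\<^sub>u)\<close>, every \<open>I\<^sub>u\<close> embeds into \<open>X\<close>, so families with \<open>'i = 'x\<close> represent all possible ones.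
\<close>

definition tail_invariant_family :: "'a rel \<Rightarrow> ('a stream \<Rightarrow> 'i rel) \<Rightarrow> bool"
  where "tail_invariant_family A I \<longleftrightarrow>
    (\<forall>u \<in> streams (Field A). Linear_order (I u)) \<and>
    (\<forall>u \<in> streams (Field A). \<forall>v \<in> streams (Field A). tail_equiv (Field A) u v \<longrightarrow> I u = I v)"

end

theory Submission
  imports Defs
begin

text \<open>
  An isomorphism \<open>X \<cong> AX\<close> reads off from each point of \<open>X\<close> a first letter in \<open>A\<close> and a
  remaining point of \<open>X\<close>; iterating it assigns to each point a code in \<open>A\<^sup>\<omega>\<close>. The coding is weakly
  monotone, so \<open>X\<close> is \<open>A\<^sup>\<omega>\<close> with each \<open>u\<close> replaced by its fibre, and forgetting the first letter
  is an isomorphism from the fibre over \<open>au\<close> to the fibre over \<open>u\<close>. Conversely, prepending a letter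
  is an isomorphism \<open>A A\<^sup>\<omega>(I\<^sub>u) \<cong> A\<^sup>\<omega>(I\<^sub>u)\<close> when \<open>I\<close> is constant on tail-equivalence classes.
\<close>

section \<open>Order isomorphisms\<close>

lemma order_isomorphicI:
  assumes "bij_betw f (Field r) (Field s)"
    and "\<And>x y. x \<in> Field r \<Longrightarrow> y \<in> Field r \<Longrightarrow> (x, y) \<in> r \<longleftrightarrow> (f x, f y) \<in> s"
  shows "r \<cong>\<^sub>o s"
  using assms unfolding order_isomorphic_def iso_iff2 by blast

lemma order_isomorphic_refl: "r \<cong>\<^sub>o r"
  by (rule order_isomorphicI[of id]) auto

lemma order_isomorphic_sym:
  assumes "r \<cong>\<^sub>o s"
  shows "s \<cong>\<^sub>o r"
proof -
  obtain f where bij: "bij_betw f (Field r) (Field s)"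
    and ord: "\<And>x y. x \<in> Field r \<Longrightarrow> y \<in> Field r \<Longrightarrow> (x, y) \<in> r \<longleftrightarrow> (f x, f y) \<in> s"
    using assms unfolding order_isomorphic_def iso_iff2 by blast
  show ?thesis
  proof (rule order_isomorphicI)
    show bij': "bij_betw (inv_into (Field r) f) (Field s) (Field r)"
      using bij by (rule bij_betw_inv_into)
    fix x y assume xy: "x \<in> Field s" "y \<in> Field s"
    with bij' have "inv_into (Field r) f x \<in> Field r" "inv_into (Field r) f y \<in> Field r"
      by (auto dest: bij_betwE)
    with ord xy show "(x, y) \<in> s \<longleftrightarrow> (inv_into (Field r) f x, inv_into (Field r) f y) \<in> r"
      using bij_betw_inv_into_right[OF bij] by simp
  qed
qed

lemma order_isomorphic_trans [trans]:
  assumes "r \<cong>\<^sub>o s" and "s \<cong>\<^sub>o t"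
  shows "r \<cong>\<^sub>o t"
proof -
  obtain f g where f: "bij_betw f (Field r) (Field s)"
    and fo: "\<And>x y. x \<in> Field r \<Longrightarrow> y \<in> Field r \<Longrightarrow> (x, y) \<in> r \<longleftrightarrow> (f x, f y) \<in> s"
    and g: "bij_betw g (Field s) (Field t)"
    and go: "\<And>x y. x \<in> Field s \<Longrightarrow> y \<in> Field s \<Longrightarrow> (x, y) \<in> s \<longleftrightarrow> (g x, g y) \<in> t"
    using assms unfolding order_isomorphic_def iso_iff2 by blast
  show ?thesis
  proof (rule order_isomorphicI)
    show "bij_betw (g \<circ> f) (Field r) (Field t)"
      using f g by (rule bij_betw_trans)
    fix x y assume "x \<in> Field r" "y \<in> Field r"
    with fo go f show "(x, y) \<in> r \<longleftrightarrow> ((g \<circ> f) x, (g \<circ> f) y) \<in> t"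
      by (auto dest: bij_betwE)
  qed
qed

text \<open>Supplies linearity where an order is known only up to isomorphism: for orders chosen to
  represent fibres, and for a replacement isomorphic to \<open>X\<close>.\<close>

lemma Linear_order_order_isomorphic:
  assumes "r \<cong>\<^sub>o s" and "Linear_order s"
  shows "Linear_order r"
proof -
  obtain f where bij: "bij_betw f (Field r) (Field s)"
    and ord: "\<And>x y. x \<in> Field r \<Longrightarrow> y \<in> Field r \<Longrightarrow> (x, y) \<in> r \<longleftrightarrow> (f x, f y) \<in> s"
    using assms unfolding order_isomorphic_def iso_iff2 by blast
  have mem: "f x \<in> Field s" if "x \<in> Field r" for x
    using bij that by (auto dest: bij_betwE)
  have inj: "x = y" if "x \<in> Field r" "y \<in> Field r" "f x = f y" for x y
    using bij that by (auto simp: bij_betw_def inj_on_def)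
  have s: "Refl s" "trans s" "antisym s" "Total s"
    using assms(2) by (auto simp: order_on_defs)
  have "Refl r"
    using s(1) mem ord by (auto simp: refl_on_def)
  moreover have "trans r"
  proof (rule transI)
    fix x y z assume xyz: "(x, y) \<in> r" "(y, z) \<in> r"
    then have "x \<in> Field r" "y \<in> Field r" "z \<in> Field r" by (auto simp: Field_def)
    with xyz ord show "(x, z) \<in> r" using transD[OF s(2)] by blast
  qed
  moreover have "antisym r"
  proof (rule antisymI)
    fix x y assume xy: "(x, y) \<in> r" "(y, x) \<in> r"
    then have "x \<in> Field r" "y \<in> Field r" by (auto simp: Field_def)
    with xy ord inj show "x = y" using antisymD[OF s(3)] by blast
  qed
  moreover have "Total r"
    using s(4) mem ord inj unfolding total_on_def by metis
  ultimately show ?thesis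
    by (auto simp: order_on_defs Field_def)
qed

section \<open>Products, powers and replacements\<close>

lemma Field_lex_product:
  assumes "Refl X"
  shows "Field (lex_product A X) = Field A \<times> Field X"
proof
  show "Field (lex_product A X) \<subseteq> Field A \<times> Field X"
  proof
    fix p assume "p \<in> Field (lex_product A X)"
    then obtain q where "(p, q) \<in> lex_product A X \<or> (q, p) \<in> lex_product A X"
      unfolding Field_def by blast
    then show "p \<in> Field A \<times> Field X"
      unfolding lex_product_def by blast
  qed
  show "Field A \<times> Field X \<subseteq> Field (lex_product A X)"
  proof
    fix p assume "p \<in> Field A \<times> Field X"
    with assms have "(p, p) \<in> lex_product A X"
      unfolding lex_product_def refl_on_def by auto
    then show "p \<in> Field (lex_product A X)"
      by (rule FieldI1)
  qed
qed

lemma Field_omega_power: "Field (omega_power A) = streams (Field A)"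
  unfolding omega_power_def by (auto simp: Field_def)

lemma Field_replacement:
  assumes "\<And>y. y \<in> Field Y \<Longrightarrow> Refl (I y)"
  shows "Field (replacement Y I) = Sigma (Field Y) (\<lambda>y. Field (I y))"
proof
  show "Field (replacement Y I) \<subseteq> Sigma (Field Y) (\<lambda>y. Field (I y))"
    unfolding replacement_def Field_def by auto
  show "Sigma (Field Y) (\<lambda>y. Field (I y)) \<subseteq> Field (replacement Y I)"
  proof clarify
    fix y i assume "y \<in> Field Y" "i \<in> Field (I y)"
    with assms have "((y, i), (y, i)) \<in> replacement Y I"
      unfolding replacement_def refl_on_def by auto
    then show "(y, i) \<in> Field (replacement Y I)"
      by (rule FieldI1)
  qed
qed

lemma lex_product_cong:
  assumes "X \<cong>\<^sub>o Y" and "Refl X" and "Refl Y"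
  shows "lex_product A X \<cong>\<^sub>o lex_product A Y"
proof -
  obtain f where bij: "bij_betw f (Field X) (Field Y)"
    and ord: "\<And>x y. x \<in> Field X \<Longrightarrow> y \<in> Field X \<Longrightarrow> (x, y) \<in> X \<longleftrightarrow> (f x, f y) \<in> Y"
    using assms(1) unfolding order_isomorphic_def iso_iff2 by blast
  have F: "Field (lex_product A X) = Field A \<times> Field X"
    "Field (lex_product A Y) = Field A \<times> Field Y"
    using assms by (simp_all add: Field_lex_product)
  show ?thesis
  proof (rule order_isomorphicI)
    show "bij_betw (map_prod id f) (Field (lex_product A X)) (Field (lex_product A Y))"
      unfolding F using bij by (intro bij_betw_map_prod) auto
    fix p q assume "p \<in> Field (lex_product A X)" "q \<in> Field (lex_product A X)"
    with ord bij show "(p, q) \<in> lex_product A X \<longleftrightarrow>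
        (map_prod id f p, map_prod id f q) \<in> lex_product A Y"
      unfolding F by (auto simp: lex_product_def dest: bij_betwE)
  qed
qed

text \<open>The first position where the streams differ is either 0 or the successor of the first
  position where their tails differ. The result has the shape of the lexicographic product with
  first factor \<open>A\<close>.\<close>

lemma omega_power_SCons:
  "(a ## u, b ## v) \<in> omega_power A \<longleftrightarrow>
     a \<in> Field A \<and> b \<in> Field A \<and> u \<in> streams (Field A) \<and> v \<in> streams (Field A) \<and>
     (a \<noteq> b \<and> (a, b) \<in> A \<or> a = b \<and> (u, v) \<in> omega_power A)"
proof -
  have ex_nat: "(\<exists>n. P n) \<longleftrightarrow> P 0 \<or> (\<exists>n. P (Suc n))" for P
    by (metis nat.exhaust)
  have "(\<exists>n. (\<forall>k<n. (a ## u) !! k = (b ## v) !! k) \<and> (a ## u) !! n \<noteq> (b ## v) !! n \<and>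
          ((a ## u) !! n, (b ## v) !! n) \<in> A) \<longleftrightarrow>
        (a \<noteq> b \<and> (a, b) \<in> A) \<or>
        (a = b \<and> (\<exists>n. (\<forall>k<n. u !! k = v !! k) \<and> u !! n \<noteq> v !! n \<and> (u !! n, v !! n) \<in> A))"
    by (subst ex_nat) (auto simp: All_less_Suc2)
  then show ?thesis
    unfolding omega_power_def mem_Collect_eq prod.case streams_Stream stream.inject by blast
qed

lemma antisym_omega_power:
  assumes "antisym A"
  shows "antisym (omega_power A)"
proof (rule antisymI, rule ccontr)
  fix u v assume "(u, v) \<in> omega_power A" "(v, u) \<in> omega_power A" "u \<noteq> v"
  then obtain m n where m: "\<forall>k<m. u !! k = v !! k" "u !! m \<noteq> v !! m" "(u !! m, v !! m) \<in> A"
    and n: "\<forall>k<n. v !! k = u !! k" "v !! n \<noteq> u !! n" "(v !! n, u !! n) \<in> A"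
    unfolding omega_power_def by auto
  \<comment> \<open>Both are the least position at which \<open>u\<close> and \<open>v\<close>
    differ.\<close>
  then have "m = n" by (metis linorder_neqE_nat)
  with m n assms show False by (auto dest: antisymD)
qed

text \<open>Regrouping \<open>(a, (u, i))\<close> as \<open>(a ## u, i)\<close> is the isomorphism.
  The index \<open>i\<close> can stay the same because the family takes literally the same value at
  \<open>a ## u\<close> and at \<open>u\<close>.\<close>

lemma lex_product_replacement_omega_power:
  assumes "tail_invariant_family A I"
  shows "lex_product A (replacement (omega_power A) I) \<cong>\<^sub>o replacement (omega_power A) I"
proof -
  let ?R = "replacement (omega_power A) I"
  have lin: "Linear_order (I u)" if "u \<in> streams (Field A)" for u
    using assms that unfolding tail_invariant_family_def by blast
  \<comment> \<open>The common tail is \<open>u\<close> itself, behind the prefixes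
    \<open>[a]\<close> and \<open>[]\<close>.\<close>
  have I: "I (a ## u) = I u" if "a \<in> Field A" "u \<in> streams (Field A)" for a u
  proof -
    have "tail_equiv (Field A) (a ## u) u"
      unfolding tail_equiv_def using that
      by (intro bexI[of _ "[a]"] bexI[of _ "[]"] bexI[of _ u]) auto
    with assms that show ?thesis unfolding tail_invariant_family_def by auto
  qed
  have FR: "Field ?R = Sigma (streams (Field A)) (\<lambda>u. Field (I u))"
    using lin by (subst Field_replacement) (auto simp: Field_omega_power order_on_defs)
  have "Refl ?R"
    unfolding refl_on_def FR using lin
    by (auto simp: replacement_def Field_omega_power order_on_defs refl_on_def)
  then have FL: "Field (lex_product A ?R) = Field A \<times> Field ?R"
    by (rule Field_lex_product)
  define c where "c = (\<lambda>(a :: 'a, u, i :: 'b). (a ## u, i))"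
  show ?thesis
  proof (rule order_isomorphicI)
    show "bij_betw c (Field (lex_product A ?R)) (Field ?R)"
      unfolding bij_betw_def
    proof
      show "inj_on c (Field (lex_product A ?R))"
        by (auto simp: inj_on_def c_def)
      show "c ` Field (lex_product A ?R) = Field ?R"
      proof
        show "c ` Field (lex_product A ?R) \<subseteq> Field ?R"
          unfolding FL FR by (auto simp: c_def I)
        show "Field ?R \<subseteq> c ` Field (lex_product A ?R)"
        proof
          fix q assume "q \<in> Field ?R"
          then obtain a u i where q: "q = (a ## u, i)" "a ## u \<in> streams (Field A)"
            "i \<in> Field (I (a ## u))"
            unfolding FR by (metis SigmaE stream.collapse)
          then have "(a, u, i) \<in> Field (lex_product A ?R)"
            unfolding FL FR using I by (auto simp: streams_Stream)
          with q(1) show "q \<in> c ` Field (lex_product A ?R)"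
            by (force simp: c_def)
        qed
      qed
    qed
    fix p q assume pq: "p \<in> Field (lex_product A ?R)" "q \<in> Field (lex_product A ?R)"
    obtain a u i b v j where eq: "p = (a, u, i)" "q = (b, v, j)"
      by (metis prod_cases3)
    show "(p, q) \<in> lex_product A ?R \<longleftrightarrow> (c p, c q) \<in> ?R"
      using pq unfolding eq FL FR
      \<comment> \<open>The replacement stays folded in the first call so that \<open>FR\<close> can
        rewrite its field; only then is its order unfolded.\<close>
      by (auto simp: c_def lex_product_def FR)
         (auto simp: replacement_def Field_omega_power omega_power_SCons I)
  qed
qed

section \<open>Decomposition into fibres\<close>

text \<open>Over a \<open>y\<close> that \<open>p\<close> does not attain this is the empty order,
  which is how empty orders enter the replacement.\<close>

definition fibre :: "'x rel \<Rightarrow> ('x \<Rightarrow> 'y) \<Rightarrow> 'y \<Rightarrow> 'x rel"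
  where "fibre X p y = Restr X {x. p x = y}"

lemma Field_fibre:
  assumes "Refl X"
  shows "Field (fibre X p y) = {x \<in> Field X. p x = y}"
  using assms unfolding fibre_def refl_on_def by (auto simp: Field_def)

lemma Linear_order_fibre: "Linear_order X \<Longrightarrow> Linear_order (fibre X p y)"
  unfolding fibre_def by (rule Linear_order_Restr)

text \<open>By weak monotonicity of \<open>p\<close>, points with different images compare as their
  images do, while points with the same image compare inside their common fibre. This is the
  lexicographic rule of a replacement, and each fibre may be exchanged for an isomorphic
  copy.\<close>

lemma order_isomorphic_replacement_fibres:
  assumes X: "Linear_order X" and Y: "antisym Y"
    and mem: "\<And>x. x \<in> Field X \<Longrightarrow> p x \<in> Field Y"
    and mono: "\<And>x y. (x, y) \<in> X \<Longrightarrow> (p x, p y) \<in> Y"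
    and I: "\<And>y. y \<in> Field Y \<Longrightarrow> fibre X p y \<cong>\<^sub>o I y"
  shows "X \<cong>\<^sub>o replacement Y I"
proof -
  have rX: "Refl X" and tX: "Total X"
    using X by (auto simp: order_on_defs)
  have FF: "Field (fibre X p y) = {x \<in> Field X. p x = y}" for y
    using rX by (rule Field_fibre)
  \<comment> \<open>Choice fixes one isomorphism per fibre, all at once.\<close>
  have "\<exists>g. \<forall>y \<in> Field Y. iso (fibre X p y) (I y) (g y)"
    using I unfolding order_isomorphic_def by (intro bchoice) blast
  then obtain g where iso: "\<And>y. y \<in> Field Y \<Longrightarrow> iso (fibre X p y) (I y) (g y)"
    by blast
  have g: "bij_betw (g y) {x \<in> Field X. p x = y} (Field (I y))" if "y \<in> Field Y" for y
    using iso[OF that] unfolding iso_iff2 FF by blast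
  have go: "(x, x') \<in> X \<longleftrightarrow> (g (p x) x, g (p x) x') \<in> I (p x)"
    if "x \<in> Field X" "x' \<in> Field X" "p x' = p x" for x x'
    using iso[OF mem[OF that(1)]] that unfolding iso_iff2 FF by (auto simp: fibre_def)
  have "Refl (I y)" if "y \<in> Field Y" for y
    using Linear_order_order_isomorphic[OF order_isomorphic_sym[OF I[OF that]]
      Linear_order_fibre[OF X]] by (simp add: order_on_defs)
  then have FR: "Field (replacement Y I) = Sigma (Field Y) (\<lambda>y. Field (I y))"
    by (rule Field_replacement)
  have gmem: "g (p x) x \<in> Field (I (p x))" if "x \<in> Field X" for x
    using g[OF mem[OF that]] that by (auto dest: bij_betwE)
  show ?thesis
  proof (rule order_isomorphicI)
    show "bij_betw (\<lambda>x. (p x, g (p x) x)) (Field X) (Field (replacement Y I))"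
      unfolding bij_betw_def FR
    proof
      show "inj_on (\<lambda>x. (p x, g (p x) x)) (Field X)"
      proof (rule inj_onI)
        fix x x' assume xx: "x \<in> Field X" "x' \<in> Field X" "(p x, g (p x) x) = (p x', g (p x') x')"
        with g[OF mem[OF xx(1)]] show "x = x'"
          unfolding bij_betw_def inj_on_def by auto
      qed
      show "(\<lambda>x. (p x, g (p x) x)) ` Field X = Sigma (Field Y) (\<lambda>y. Field (I y))"
      proof
        show "(\<lambda>x. (p x, g (p x) x)) ` Field X \<subseteq> Sigma (Field Y) (\<lambda>y. Field (I y))"
          using mem gmem by auto
        show "Sigma (Field Y) (\<lambda>y. Field (I y)) \<subseteq> (\<lambda>x. (p x, g (p x) x)) ` Field X"
        proof clarify
          fix y i assume "y \<in> Field Y" "i \<in> Field (I y)"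
          then obtain x where "x \<in> Field X" "p x = y" "i = g y x"
            using g[of y] unfolding bij_betw_def by blast
          then show "(y, i) \<in> (\<lambda>x. (p x, g (p x) x)) ` Field X" by auto
        qed
      qed
    qed
    fix x x' assume xx: "x \<in> Field X" "x' \<in> Field X"
    \<comment> \<open>A strict comparison of images is reflected: otherwise totality gives
      \<open>(x', x) \<in> X\<close>, and monotonicity contradicts antisymmetry of
      \<open>Y\<close>.\<close>
    have "(x, x') \<in> X" if "p x \<noteq> p x'" "(p x, p x') \<in> Y"
    proof (rule ccontr)
      assume "(x, x') \<notin> X"
      with that xx tX have "(x', x) \<in> X" unfolding total_on_def by metis
      with mono that Y show False by (auto dest: antisymD)
    qed
    with xx mem gmem mono go[OF xx]
    show "(x, x') \<in> X \<longleftrightarrow> ((p x, g (p x) x), (p x', g (p x') x')) \<in> replacement Y I"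
      unfolding replacement_def by auto
  qed
qed

section \<open>The coding of points by streams\<close>

text \<open>Viewing \<open>h\<close> as a coalgebra, this is its map to the final coalgebra of
  streams, the only function satisfying the equation of \<open>code_stream_unfold\<close>.\<close>

definition code_stream :: "('x \<Rightarrow> 'a \<times> 'x) \<Rightarrow> 'x \<Rightarrow> 'a stream"
  where "code_stream h x = smap (fst \<circ> h) (siterate (snd \<circ> h) x)"

lemma code_stream_unfold: "code_stream h x = fst (h x) ## code_stream h (snd (h x))"
  unfolding code_stream_def by (subst siterate.code) simp

locale product_isomorphism =
  fixes A :: "'a rel" and X :: "'x rel" and h :: "'x \<Rightarrow> 'a \<times> 'x"
  assumes Linear_X: "Linear_order X"
    and bij_h: "bij_betw h (Field X) (Field A \<times> Field X)"
    and order_h: "\<And>x y. x \<in> Field X \<Longrightarrow> y \<in> Field X \<Longrightarrow>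
      (x, y) \<in> X \<longleftrightarrow> (h x, h y) \<in> lex_product A X"
begin

abbreviation code :: "'x \<Rightarrow> 'a stream"
  where "code \<equiv> code_stream h"

lemma h_mem: "x \<in> Field X \<Longrightarrow> fst (h x) \<in> Field A \<and> snd (h x) \<in> Field X"
  using bij_betwE[OF bij_h] by (metis mem_Times_iff)

lemma code_snth: "code x !! 0 = fst (h x)" "code x !! Suc k = code (snd (h x)) !! k"
  by (subst code_stream_unfold, simp)+

lemma code_in_streams:
  assumes "x \<in> Field X"
  shows "code x \<in> streams (Field A)"
proof -
  have "code x !! n \<in> Field A" for n
    using assms
    by (induction n arbitrary: x) (use h_mem in \<open>auto simp only: code_snth\<close>)
  then show ?thesis by (simp add: streams_iff_snth)
qed

text \<open>As long as first letters agree, the comparison in \<open>AX\<close> falls to the second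
  coordinates and so passes to the remaining points. At the first disagreement the letters
  themselves decide it. Hence the induction on \<open>n\<close> varies \<open>x\<close> and
  \<open>y\<close>.\<close>

lemma first_difference_code:
  assumes "(x, y) \<in> X" and "\<forall>k<n. code x !! k = code y !! k" and "code x !! n \<noteq> code y !! n"
  shows "(code x !! n, code y !! n) \<in> A"
  using assms
proof (induction n arbitrary: x y)
  case 0
  have "(h x, h y) \<in> lex_product A X"
    using 0(1) order_h by (metis FieldI1 FieldI2)
  with 0(3) show ?case
    unfolding code_snth by (auto simp: lex_product_def)
next
  case (Suc n)
  have "(h x, h y) \<in> lex_product A X"
    using Suc.prems(1) order_h by (metis FieldI1 FieldI2)
  moreover have "fst (h x) = fst (h y)"
    using Suc.prems(2) code_snth(1) by (metis zero_less_Suc)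
  ultimately have "(snd (h x), snd (h y)) \<in> X"
    by (auto simp: lex_product_def)
  moreover have "\<forall>k<n. code (snd (h x)) !! k = code (snd (h y)) !! k"
    using Suc.prems(2) code_snth(2) by (metis Suc_less_eq)
  ultimately show ?case
    using Suc.IH Suc.prems(3) unfolding code_snth(2) by blast
qed

lemma code_mono:
  assumes "(x, y) \<in> X"
  shows "(code x, code y) \<in> omega_power A"
proof (cases "code x = code y")
  case True
  then show ?thesis
    using code_in_streams[OF FieldI1[OF assms]] by (simp add: omega_power_def)
next
  case False
  then obtain m where "code x !! m \<noteq> code y !! m"
    by (metis smap_alt stream.map_id)
  \<comment> \<open>The least position of difference is the one at which \<open>omega_power\<close>
    compares the codes.\<close>
  then obtain n where n: "code x !! n \<noteq> code y !! n" "\<forall>k<n. code x !! k = code y !! k"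
    using exists_least_iff[of "\<lambda>n. code x !! n \<noteq> code y !! n"] by auto
  with first_difference_code[OF assms] have "(code x !! n, code y !! n) \<in> A"
    by blast
  with n assms show ?thesis
    using code_in_streams by (auto simp: omega_power_def intro: FieldI1 FieldI2)
qed

section \<open>Fibres of the coding over tail-equivalent streams\<close>

lemma Field_fibre_code: "Field (fibre X code u) = {x \<in> Field X. code x = u}"
  using Linear_X by (intro Field_fibre) (auto simp: order_on_defs)

text \<open>All points of the fibre over \<open>a ## u\<close> have first letter \<open>a\<close>,
  so \<open>snd (h x)\<close> determines \<open>h x\<close>, and comparison in \<open>AX\<close>
  reduces to second coordinates.\<close>

lemma fibre_code_SCons:
  assumes a: "a \<in> Field A"
  shows "fibre X code (a ## u) \<cong>\<^sub>o fibre X code u"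
proof -
  have split: "code x = a ## u \<longleftrightarrow> fst (h x) = a \<and> code (snd (h x)) = u" for x
    by (subst code_stream_unfold) simp
  show ?thesis
  proof (rule order_isomorphicI)
    show "bij_betw (\<lambda>x. snd (h x)) (Field (fibre X code (a ## u))) (Field (fibre X code u))"
      unfolding bij_betw_def Field_fibre_code split
    proof
      show "inj_on (\<lambda>x. snd (h x)) {x \<in> Field X. fst (h x) = a \<and> code (snd (h x)) = u}"
        using bij_h by (auto simp: bij_betw_def inj_on_def prod_eq_iff)
      show "(\<lambda>x. snd (h x)) ` {x \<in> Field X. fst (h x) = a \<and> code (snd (h x)) = u}
          = {x \<in> Field X. code x = u}"
      proof
        show "(\<lambda>x. snd (h x)) ` {x \<in> Field X. fst (h x) = a \<and> code (snd (h x)) = u}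
            \<subseteq> {x \<in> Field X. code x = u}"
          using h_mem by auto
        show "{x \<in> Field X. code x = u}
            \<subseteq> (\<lambda>x. snd (h x)) ` {x \<in> Field X. fst (h x) = a \<and> code (snd (h x)) = u}"
        proof clarify
          fix y assume y: "y \<in> Field X" "u = code y"
          \<comment> \<open>Since \<open>a\<close> lies in \<open>Field A\<close>, the pair
            \<open>(a, y)\<close> is in the range of \<open>h\<close>; its preimage has code
            \<open>a ## u\<close>.\<close>
          with a bij_h obtain x where "x \<in> Field X" "h x = (a, y)"
            unfolding bij_betw_def by (metis (no_types, lifting) imageE mem_Sigma_iff)
          then show "y \<in> (\<lambda>x. snd (h x)) `
              {x \<in> Field X. fst (h x) = a \<and> code (snd (h x)) = code y}"
            by force
        qed
      qed
    qed
    fix x y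
    assume "x \<in> Field (fibre X code (a ## u))" "y \<in> Field (fibre X code (a ## u))"
    then have xy: "x \<in> Field X" "y \<in> Field X" "code x = a ## u" "code y = a ## u"
      by (auto simp: Field_fibre_code)
    then obtain x' y' where h: "h x = (a, x')" "h y = (a, y')" "code x' = u" "code y' = u"
      unfolding split by (metis prod.collapse)
    then have "(h x, h y) \<in> lex_product A X \<longleftrightarrow> (x', y') \<in> X"
      using a h_mem[OF xy(1)] h_mem[OF xy(2)] by (auto simp: lex_product_def)
    with h xy order_h[OF xy(1,2)]
    show "(x, y) \<in> fibre X code (a ## u) \<longleftrightarrow> (snd (h x), snd (h y)) \<in> fibre X code u"
      by (auto simp: fibre_def)
  qed
qed

lemma fibre_code_shift:
  "r \<in> lists (Field A) \<Longrightarrow> fibre X code (r @- u) \<cong>\<^sub>o fibre X code u"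
proof (induction r)
  case Nil
  then show ?case by (simp add: order_isomorphic_refl)
next
  case (Cons a r)
  then show ?case
    using fibre_code_SCons[of a "r @- u"] order_isomorphic_trans by fastforce
qed

text \<open>Removing the two prefixes letter by letter reduces both fibres to the one over the
  common tail.\<close>

lemma fibre_code_tail_equiv:
  assumes "tail_equiv (Field A) u v"
  shows "fibre X code u \<cong>\<^sub>o fibre X code v"
proof -
  obtain r s w where r: "r \<in> lists (Field A)" and s: "s \<in> lists (Field A)"
    and eq: "u = r @- w" "v = s @- w"
    using assms unfolding tail_equiv_def by blast
  show ?thesis
    unfolding eq
    by (rule order_isomorphic_trans[OF fibre_code_shift[OF r]
          order_isomorphic_sym[OF fibre_code_shift[OF s]]])
qed

text \<open>
  Fibres over tail-equivalent codes are only isomorphic, whereas the family must be literally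
  constant on classes; choosing one representative per isomorphism type achieves this.
\<close>

lemma ex_tail_invariant_family:
  assumes "antisym A"
  shows "\<exists>I :: 'a stream \<Rightarrow> 'x rel.
    tail_invariant_family A I \<and> X \<cong>\<^sub>o replacement (omega_power A) I"
proof -
  define I :: "'a stream \<Rightarrow> 'x rel" where "I u = (SOME r. r \<cong>\<^sub>o fibre X code u)" for u
  have I: "I u \<cong>\<^sub>o fibre X code u" for u
    unfolding I_def by (rule someI) (rule order_isomorphic_refl)
  have "I u = I v" if "tail_equiv (Field A) u v" for u v
  proof -
    \<comment> \<open>\<open>SOME\<close> depends only on its predicate, and isomorphic fibres give
      the same predicate, so the chosen orders are equal.\<close>
    have "(\<lambda>r :: 'x rel. r \<cong>\<^sub>o fibre X code u) = (\<lambda>r. r \<cong>\<^sub>o fibre X code v)"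
      using order_isomorphic_trans[OF _ fibre_code_tail_equiv[OF that]]
        order_isomorphic_trans[OF _ order_isomorphic_sym[OF fibre_code_tail_equiv[OF that]]]
      by blast
    then show ?thesis by (simp add: I_def)
  qed
  moreover have "Linear_order (I u)" for u
    using I Linear_order_fibre[OF Linear_X] by (rule Linear_order_order_isomorphic)
  ultimately have "tail_invariant_family A I"
    unfolding tail_invariant_family_def by blast
  moreover have "X \<cong>\<^sub>o replacement (omega_power A) I"
    using Linear_X antisym_omega_power[OF assms] code_in_streams code_mono order_isomorphic_sym[OF I]
    by (intro order_isomorphic_replacement_fibres) (auto simp: Field_omega_power)
  ultimately show ?thesis by blast
qed

end

section \<open>Absorption of \<open>A\<close> and the equivalence\<close>

lemma lex_product_absorbs:
  assumes "Linear_order X" and "tail_invariant_family A I"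
    and "X \<cong>\<^sub>o replacement (omega_power A) I"
  shows "lex_product A X \<cong>\<^sub>o X"
proof -
  let ?R = "replacement (omega_power A) I"
  have "Refl X" "Refl ?R"
    \<comment> \<open>Reflexivity of \<open>?R\<close> is transported from \<open>X\<close>.\<close>
    using assms(1) Linear_order_order_isomorphic[OF order_isomorphic_sym[OF assms(3)] assms(1)]
    by (auto simp: order_on_defs)
  \<comment> \<open>With \<open>R\<close> for the replacement, the chain is \<open>AX\<close>,
    \<open>AR\<close>, \<open>R\<close>, \<open>X\<close>: the absorption property of
    \<open>R\<close> is carried over to \<open>X\<close>.\<close>
  then have "lex_product A X \<cong>\<^sub>o lex_product A ?R"
    using assms(3) by (intro lex_product_cong)
  also note lex_product_replacement_omega_power[OF assms(2)]
  also note order_isomorphic_sym[OF assms(3)]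
  finally show ?thesis .
qed

theorem theorem3p5:
  fixes A :: "'a rel" and X :: "'x rel"
  assumes "Linear_order A" and "Linear_order X"
  shows "(lex_product A X \<cong>\<^sub>o X \<longleftrightarrow>
           (\<exists>I :: 'a stream \<Rightarrow> 'x rel.
              tail_invariant_family A I \<and> X \<cong>\<^sub>o replacement (omega_power A) I)) \<and>
         (\<forall>I :: 'a stream \<Rightarrow> 'i rel.
              tail_invariant_family A I \<and> X \<cong>\<^sub>o replacement (omega_power A) I \<longrightarrow>
              lex_product A X \<cong>\<^sub>o X)"
proof -
  have "\<exists>I :: 'a stream \<Rightarrow> 'x rel.
      tail_invariant_family A I \<and> X \<cong>\<^sub>o replacement (omega_power A) I"
    if absorbs: "lex_product A X \<cong>\<^sub>o X"
  proof -
    \<comment> \<open>The isomorphism is inverted to run from \<open>X\<close> to \<open>AX\<close>,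
      the direction that can be iterated to read off letters.\<close>
    obtain h where h: "iso X (lex_product A X) h"
      using order_isomorphic_sym[OF absorbs] unfolding order_isomorphic_def by blast
    have "Refl X" using assms(2) by (simp add: order_on_defs)
    then interpret product_isomorphism A X h
      using h assms(2) by unfold_locales (auto simp: iso_iff2 Field_lex_product)
    show ?thesis
      using assms(1) by (intro ex_tail_invariant_family) (simp add: order_on_defs)
  qed
  then show ?thesis
    \<comment> \<open>The lemma leaves the index type free, so it yields both the converse for
      families on \<open>'x\<close> and the second conjunct for families on
      \<open>'i\<close>.\<close>
    by (blast intro: lex_product_absorbs[OF assms(2)])
qed

end
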